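(* The equation $(2^{n}-1)(50^{n}-1)=x^{2}$ in positive integers $n,x$ has only the solution $n=1$, $x=7$. *)

theory Defs
  imports Main
begin

end

theory Submission
  imports Defs
begin

text \<open>
  Put \<open>u = 2 ^ n\<close> and \<open>v = 5 ^ n\<close>. Then \<open>50 ^ n = u * v\<^sup>2\<close>, so the equation becomes the
  conic \<open>x\<^sup>2 = (u - 1) * (u * v\<^sup>2 - 1)\<close>, that is, the Pell-type equation
  \<open>x\<^sup>2 - u * (u - 1) * v\<^sup>2 = - (u - 1)\<close>. The number
  \<open>2 * u - 1 + 2 * sqrt (u * (u - 1)) = (sqrt u + sqrt (u - 1))\<^sup>2\<close> has norm \<open>1\<close>, and
  multiplication by its inverse is a descent on the solutions. For every integer \<open>u \<ge> 2\<close>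
  each step with \<open>v \<ge> 2\<close> lowers \<open>v\<close> and keeps it positive, and \<open>x\<close> stays nonnegative
  (\<open>conic_descent\<close>). Hence it ends in \<open>v = 1\<close>, so the nonnegative solutions form a
  single orbit (\<open>conic_solution_in_orbit\<close>), with
  \<open>v = 1, 4 * u - 3, 16 * u\<^sup>2 - 20 * u + 5, \<dots>\<close>.

  It remains to find \<open>5 ^ n\<close> in the orbit. From the fourth term on, the terms are at least
  \<open>u ^ 3 = 8 ^ n\<close> (\<open>orbit_lower_bounds\<close>), which is too large. The first term is \<open>1\<close>. The third
  is congruent to \<open>u\<^sup>2\<close> modulo \<open>5\<close>, hence prime to \<open>5\<close>. The second gives
  \<open>5 ^ n = 4 * 2 ^ n - 3\<close>, which fails for \<open>n \<ge> 2\<close> by growth and leaves \<open>n = 1\<close>.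
\<close>

definition on_conic :: "int \<Rightarrow> int \<Rightarrow> int \<Rightarrow> bool" where
  "on_conic u v x \<longleftrightarrow> x\<^sup>2 = (u - 1) * (u * v\<^sup>2 - 1)"

text \<open>
  The pair \<open>(v, x)\<close> at index \<open>k\<close> is given by
  \<open>v * sqrt u + x / sqrt (u - 1) = (sqrt u + sqrt (u - 1)) ^ (2 * k + 1)\<close>.
\<close>

fun orbit :: "int \<Rightarrow> nat \<Rightarrow> int \<times> int" where
  "orbit u 0 = (1, u - 1)"
| "orbit u (Suc k) =
     (case orbit u k of (v, x) \<Rightarrow> ((2*u - 1) * v + 2 * x, 2*u*(u - 1) * v + (2*u - 1) * x))"

text \<open>
  The slope bound \<open>x \<ge> (u - 1) * v\<close> is what makes a step multiply \<open>v\<close> by at least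
  \<open>(2 * u - 1) + 2 * (u - 1)\<close>.
\<close>

lemma orbit_lower_bounds:
  assumes "u \<ge> 2"
  shows "fst (orbit u k) \<ge> (4*u - 3) ^ k \<and> snd (orbit u k) \<ge> (u - 1) * fst (orbit u k)"
proof (induction k)
  case 0
  show ?case by simp
next
  case (Suc k)
  obtain v x where vx: "orbit u k = (v, x)" by fastforce
  have v: "v \<ge> (4*u - 3) ^ k" and x: "x \<ge> (u - 1) * v"
    using Suc vx by auto
  have "(4*u - 3) ^ k > 0" using assms by simp
  hence "v \<ge> 0" using v by linarith
  hence "(u - 1) * v \<ge> 0" using assms by simp
  moreover have "2*u*(u - 1) * v + (2*u - 1) * x - (u - 1) * ((2*u - 1) * v + 2 * x)
      = (u - 1) * v + x"
    by (simp add: algebra_simps)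
  ultimately have "2*u*(u - 1) * v + (2*u - 1) * x \<ge> (u - 1) * ((2*u - 1) * v + 2 * x)"
    using x by linarith
  moreover have "(4*u - 3) * (4*u - 3) ^ k \<le> (4*u - 3) * v"
    using v assms by (intro mult_left_mono) auto
  hence "(4*u - 3) ^ Suc k \<le> (2*u - 1) * v + 2 * x"
    using x by (simp add: algebra_simps)
  ultimately show ?case using vx by simp
qed

text \<open>
  The difference of the two squares is \<open>(u - 1) * (v\<^sup>2 - 1)\<close>; it vanishes exactly at the
  endpoint \<open>v = 1\<close> of the descent.
\<close>

lemma conic_slope_bound:
  assumes "u \<ge> 2" "v \<ge> 1" "x \<ge> 0" "on_conic u v x"
  shows "x \<ge> (u - 1) * v"
proof (rule power2_le_imp_le)
  have "v\<^sup>2 \<ge> 1" using assms(2) by simp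
  hence "(u - 1) * ((u - 1) * v\<^sup>2) \<le> (u - 1) * (u * v\<^sup>2 - 1)"
    using assms(1) by (intro mult_left_mono) (auto simp: algebra_simps)
  thus "((u - 1) * v)\<^sup>2 \<le> x\<^sup>2"
    using assms(4) by (simp add: on_conic_def power2_eq_square algebra_simps)
qed (use assms in simp)

lemma conic_slope_bound_strict:
  assumes "u \<ge> 2" "v \<ge> 2" "x \<ge> 0" "on_conic u v x"
  shows "x > (u - 1) * v"
proof (rule power2_less_imp_less)
  have "1 < v\<^sup>2" using assms(2) by (simp add: power2_eq_square less_1_mult)
  hence "(u - 1) * ((u - 1) * v\<^sup>2) < (u - 1) * (u * v\<^sup>2 - 1)"
    using assms(1) by (intro mult_strict_left_mono) (auto simp: algebra_simps)
  thus "((u - 1) * v)\<^sup>2 < x\<^sup>2"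
    using assms(4) by (simp add: on_conic_def power2_eq_square algebra_simps)
qed (use assms in simp)

text \<open>
  The inverse step leaves the conic invariant. The slope bound, in its strict form, says that
  this step decreases \<open>v\<close>. The same bound at the new point says that a sign change of \<open>x\<close>
  would make the forward step bring \<open>v\<close> no higher than it was, so the new \<open>x\<close> is
  nonnegative and the orbit is not left.
\<close>

lemma conic_descent:
  assumes "u \<ge> 2" "v \<ge> 2" "x \<ge> 0" "on_conic u v x"
  defines "v' \<equiv> (2*u - 1) * v - 2 * x" and "x' \<equiv> (2*u - 1) * x - 2*u*(u - 1) * v"
  shows "on_conic u v' x'" "1 \<le> v'" "v' < v" "0 \<le> x'"
    "v = (2*u - 1) * v' + 2 * x'" "x = 2*u*(u - 1) * v' + (2*u - 1) * x'"
proof -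
  have eq: "x\<^sup>2 = (u - 1) * (u * v\<^sup>2 - 1)"
    using assms(4) by (simp add: on_conic_def)
  have "x'\<^sup>2 - (u - 1) * (u * v'\<^sup>2 - 1) = x\<^sup>2 - (u - 1) * (u * v\<^sup>2 - 1)"
    unfolding v'_def x'_def by (simp add: power2_eq_square algebra_simps)
  thus conic: "on_conic u v' x'"
    using eq by (simp add: on_conic_def)
  show v_eq: "v = (2*u - 1) * v' + 2 * x'" and "x = 2*u*(u - 1) * v' + (2*u - 1) * x'"
    unfolding v'_def x'_def by (simp_all add: algebra_simps)
  show less: "v' < v"
    using conic_slope_bound_strict[OF assms(1-4)] by (simp add: v'_def algebra_simps)
  have "((2*u - 1) * v)\<^sup>2 - (2 * x)\<^sup>2 = v\<^sup>2 + 4 * (u - 1)"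
    using eq by (simp add: power_mult_distrib) (simp add: power2_eq_square algebra_simps)
  also have "\<dots> > 0" using assms(1) by (simp add: add_nonneg_pos)
  finally have "(2 * x)\<^sup>2 < ((2*u - 1) * v)\<^sup>2" by (simp only: diff_gt_0_iff_gt)
  hence "2 * x < (2*u - 1) * v"
    by (rule power2_less_imp_less) (use assms in simp)
  thus pos: "1 \<le> v'" by (simp add: v'_def)
  show "0 \<le> x'"
  proof (rule ccontr)
    assume neg: "\<not> 0 \<le> x'"
    have "- x' \<ge> (u - 1) * v'"
      by (rule conic_slope_bound) (use assms(1) pos neg conic in \<open>auto simp: on_conic_def\<close>)
    hence "v \<le> v'" using v_eq by (simp add: algebra_simps)
    thus False using less by simp
  qed
qed

lemma conic_solution_in_orbit:
  assumes "u \<ge> 2" "v \<ge> 1" "x \<ge> 0" "on_conic u v x"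
  shows "\<exists>k. orbit u k = (v, x)"
  using assms(2-4)
proof (induction "nat v" arbitrary: v x rule: less_induct)
  case less
  show ?case
  proof (cases "v = 1")
    case True
    hence "x\<^sup>2 = (u - 1)\<^sup>2"
      using less.prems by (simp add: on_conic_def power2_eq_square)
    hence "x = u - 1" using less.prems assms(1) by (simp add: power2_eq_iff_nonneg)
    hence "orbit u 0 = (v, x)" using True by simp
    thus ?thesis by blast
  next
    case False
    hence v: "v \<ge> 2" using less.prems by simp
    define v' where "v' = (2*u - 1) * v - 2 * x"
    define x' where "x' = (2*u - 1) * x - 2*u*(u - 1) * v"
    note descent = conic_descent[OF assms(1) v less.prems(2,3), folded v'_def x'_def]
    have "\<exists>k. orbit u k = (v', x')"
      using descent v by (intro less.hyps) auto
    then obtain k where "orbit u k = (v', x')" ..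
    hence "orbit u (Suc k) = (v, x)" using descent by simp
    thus ?thesis by blast
  qed
qed

lemma five_pow_in_orbit_of_two_pow:
  assumes "n > 0" and orbit: "orbit (2 ^ n) k = (5 ^ n, x)"
  shows "n = 1"
proof -
  define u :: int where "u = 2 ^ n"
  have u: "u \<ge> 2" using power_increasing[of 1 n "2::int"] assms(1) by (simp add: u_def)
  have v: "fst (orbit u k) = 5 ^ n" using orbit by (simp add: u_def)
  have five_dvd: "(5::int) dvd 5 ^ n" using assms(1) by (simp add: dvd_power)
  have "k < 3"
  proof (rule ccontr)
    assume "\<not> k < 3"
    hence "(4*u - 3) ^ 3 \<le> (4*u - 3) ^ k"
      using u by (intro power_increasing) auto
    moreover have "u ^ 3 \<le> (4*u - 3) ^ 3" using u by (intro power_mono) auto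
    moreover have "(4*u - 3) ^ k \<le> 5 ^ n"
      using orbit_lower_bounds[OF u, of k] v by simp
    moreover have "u ^ 3 = 8 ^ n"
      using power_mult[of "2::int" 3 n] by (simp add: u_def mult.commute flip: power_mult)
    moreover have "(5::int) ^ n < 8 ^ n"
      using assms(1) by (intro power_strict_mono) auto
    ultimately show False by linarith
  qed
  then consider "k = 0" | "k = 1" | "k = 2" by linarith
  thus ?thesis
  proof cases
    case 1
    hence "5 dvd (1::int)" using v five_dvd by simp
    thus ?thesis by simp
  next
    case 2
    hence eq: "5 ^ n = 4 * u - 3" using v by simp
    show ?thesis
    proof (rule ccontr)
      assume "n \<noteq> 1"
      then obtain m where m: "n = m + 2"
        using assms(1) by (metis One_nat_def Suc_pred add_2_eq_Suc' neq0_conv)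
      have "(2::int) ^ m \<le> 5 ^ m" by (intro power_mono) auto
      moreover have "(0::int) < 5 ^ m" by simp
      moreover have "25 * (5::int) ^ m = 16 * 2 ^ m - 3"
        using eq by (simp add: u_def m power_add)
      ultimately show False by linarith
    qed
  next
    case 3
    hence "5 ^ n = 16 * u\<^sup>2 - 20 * u + 5"
      using v by (simp add: numeral_2_eq_2) (simp add: power2_eq_square algebra_simps)
    hence "16 * u\<^sup>2 = 5 ^ n + 5 * (4 * u - 1)" by simp
    hence "5 dvd 16 * u\<^sup>2" using five_dvd by (metis dvd_add dvd_triv_left)
    moreover have "16 * u\<^sup>2 = 2 ^ (4 + n * 2)" by (simp add: u_def power_add power_mult)
    moreover have "coprime (5::int) (2 ^ (4 + n * 2))"
      by (simp only: coprime_power_right_iff coprime_right_2_iff_odd) simp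
    ultimately have "is_unit (5::int)"
      by (metis coprime_common_divisor dvd_refl)
    thus ?thesis by simp
  qed
qed

theorem theorem21:
  fixes n :: nat and x :: int
  assumes "n > 0" and "x > 0"
  shows "(2 ^ n - 1) * (50 ^ n - 1) = x ^ 2 \<longleftrightarrow> n = 1 \<and> x = 7"
proof
  assume eq: "(2 ^ n - 1) * (50 ^ n - 1) = x ^ 2"
  have "(50::int) ^ n = 2 ^ n * (5 ^ n)\<^sup>2"
    by (simp add: power_mult[symmetric] mult.commute[of n])
       (simp add: power_mult power_mult_distrib[symmetric])
  hence "on_conic (2 ^ n) (5 ^ n) x" using eq by (simp add: on_conic_def)
  moreover have "(2::int) ^ n \<ge> 2"
    using power_increasing[of 1 n "2::int"] assms(1) by simp
  ultimately obtain k where "orbit (2 ^ n) k = (5 ^ n, x)"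
    using conic_solution_in_orbit[of "2 ^ n" "5 ^ n" x] assms(2) by auto
  hence n: "n = 1" using five_pow_in_orbit_of_two_pow assms(1) by blast
  hence "x\<^sup>2 = 7\<^sup>2" using eq by simp
  hence "x = 7" by (rule power2_eq_imp_eq) (use assms(2) in simp_all)
  with n show "n = 1 \<and> x = 7" by simp
next
  assume "n = 1 \<and> x = 7"
  thus "(2 ^ n - 1) * (50 ^ n - 1) = x ^ 2" by simp
qed

end
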